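(* Let $k\ge 1$ be an integer. Let $G_L$ be an $\ell$-$LP_1$-snark with $\sigma\ge 1$ link-vertices, where $\ell\ge 3$ is odd. Then $i_{[kR]}(G_L)\le 2(k+1)\ell+k\sigma$.
   Context: A basic block $B_i$ has vertices $p_i,q_i,r_i,s_i,t_i,u_i,v_i$ and edges $p_it_i,t_iq_i,q_ir_i,r_is_i,s_ip_i,u_iv_i,u_ip_i,v_iq_i$. For odd $\ell\ge3$, an $\ell$-$LP_1$-snark is built from disjoint blocks $B_0,\ldots,B_{\ell-1}$ as follows: for each $i\in\{0,\ldots,\ell-1\}$ (indices modulo $\ell$) add either the pair of edges $\{s_ir_{i+1},v_iu_{i+1}\}$ or the pair $\{s_iu_{i+1},v_ir_{i+1}\}$ (plug-edges); then choose an odd number $\sigma$ with $1\le\sigma\le\lfloor\ell/3\rfloor$ of pairwise disjoint triples $\{t_i,t_j,t_s\}$ and for each such triple add a new vertex (link-vertex) adjacent to $t_i,t_j,t_s$; finally, the remaining $\ell-3\sigma$ vertices $t_i$ are paired up and each pair $t_i,t_j$ is joined by an edge (repairing edge). For $f\colon V(G)\to\mathbb{Z}_{\ge 0}$ and $S\subseteq V(G)$, $f(S)=\sum_{v\in S}f(v)$, and $AN(v)=\{w\in N(v): f(w)\ge 1\}$. A $[k]$-Roman dominating function of $G$ is a function $f\colon V(G)\to\{0,1,\ldots,k+1\}$ such that $f(N[v])\ge k+|AN(v)|$ for every vertex $v$ with $f(v)<k$; its weight is $f(V(G))$. $i_{[kR]}(G)$ is the minimum weight of such a function whose set of vertices with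 positive label is independent. *)

theory Defs
  imports "HOL-Library.Disjoint_Sets"
begin

text \<open>A finite simple graph is given by a vertex set \<open>V\<close> and a set \<open>E\<close> of two-element
  subsets of \<open>V\<close>.\<close>

definition simple_graph :: "'a set \<Rightarrow> 'a set set \<Rightarrow> bool" where
  "simple_graph V E \<longleftrightarrow> finite V \<and> (\<forall>e\<in>E. e \<subseteq> V \<and> card e = 2)"

definition nbhd :: "'a set set \<Rightarrow> 'a \<Rightarrow> 'a set" where
  "nbhd E v = {w. {v, w} \<in> E}"

definition closed_nbhd :: "'a set set \<Rightarrow> 'a \<Rightarrow> 'a set" where
  "closed_nbhd E v = insert v (nbhd E v)"

definition active_nbhd :: "'a set set \<Rightarrow> ('a \<Rightarrow> nat) \<Rightarrow> 'a \<Rightarrow> 'a set" where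
  "active_nbhd E f v = {w \<in> nbhd E v. f w \<ge> 1}"

definition independent_set :: "'a set set \<Rightarrow> 'a set \<Rightarrow> bool" where
  "independent_set E S \<longleftrightarrow> (\<forall>x\<in>S. \<forall>y\<in>S. {x, y} \<notin> E)"

text \<open>Labellings are total functions on the vertex type; only their values on \<open>V\<close> matter.\<close>

definition k_roman_dominating ::
    "nat \<Rightarrow> 'a set \<Rightarrow> 'a set set \<Rightarrow> ('a \<Rightarrow> nat) \<Rightarrow> bool" where
  "k_roman_dominating k V E f \<longleftrightarrow>
     (\<forall>v\<in>V. f v \<le> k + 1) \<and>
     (\<forall>v\<in>V. f v < k \<longrightarrow>
        (\<Sum>w\<in>closed_nbhd E v. f w) \<ge> k + card (active_nbhd E f v))"

definition independent_k_roman_dominating ::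
    "nat \<Rightarrow> 'a set \<Rightarrow> 'a set set \<Rightarrow> ('a \<Rightarrow> nat) \<Rightarrow> bool" where
  "independent_k_roman_dominating k V E f \<longleftrightarrow>
     k_roman_dominating k V E f \<and> independent_set E {v \<in> V. f v > 0}"

text \<open>The infimum is over a set of natural numbers; it is an attained minimum on every
  finite simple graph, see \<open>i_kR_attained\<close> below.\<close>

definition i_kR :: "nat \<Rightarrow> 'a set \<Rightarrow> 'a set set \<Rightarrow> nat" where
  "i_kR k V E = Inf {(\<Sum>v\<in>V. f v) | f. independent_k_roman_dominating k V E f}"

text \<open>The vertices \<open>p\<^sub>i, q\<^sub>i, \<dots>, v\<^sub>i\<close> of the blocks; a link-vertex is named by the set of the
  three indices of the triple it is added for.\<close>

datatype lp_vertex =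
    Pv nat | Qv nat | Rv nat | Sv nat | Tv nat | Uv nat | Vv nat | Link "nat set"

definition block_verts :: "nat \<Rightarrow> lp_vertex set" where
  "block_verts i = {Pv i, Qv i, Rv i, Sv i, Tv i, Uv i, Vv i}"

definition block_edges :: "nat \<Rightarrow> lp_vertex set set" where
  "block_edges i =
     {{Pv i, Tv i}, {Tv i, Qv i}, {Qv i, Rv i}, {Rv i, Sv i}, {Sv i, Pv i},
      {Uv i, Vv i}, {Uv i, Pv i}, {Vv i, Qv i}}"

text \<open>The function \<open>c\<close> selects, for each \<open>i\<close>, one of the two pairs of plug-edges.\<close>

definition plug_edges :: "nat \<Rightarrow> (nat \<Rightarrow> bool) \<Rightarrow> nat \<Rightarrow> lp_vertex set set" where
  "plug_edges l c i =
     (if c i then {{Sv i, Rv ((i + 1) mod l)}, {Vv i, Uv ((i + 1) mod l)}}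
      else {{Sv i, Uv ((i + 1) mod l)}, {Vv i, Rv ((i + 1) mod l)}})"

definition link_edges :: "nat set set \<Rightarrow> lp_vertex set set" where
  "link_edges A = {{Link X, Tv i} | X i. X \<in> A \<and> i \<in> X}"

definition repairing_edges :: "nat set set \<Rightarrow> lp_vertex set set" where
  "repairing_edges M = {{Tv i, Tv j} | i j. {i, j} \<in> M}"

definition LP1_verts :: "nat \<Rightarrow> nat set set \<Rightarrow> lp_vertex set" where
  "LP1_verts l A = (\<Union>i<l. block_verts i) \<union> Link ` A"

definition LP1_edges ::
    "nat \<Rightarrow> (nat \<Rightarrow> bool) \<Rightarrow> nat set set \<Rightarrow> nat set set \<Rightarrow> lp_vertex set set" where
  "LP1_edges l c A M =
     (\<Union>i<l. block_edges i \<union> plug_edges l c i) \<union> link_edges A \<union> repairing_edges M"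

text \<open>\<open>A\<close> is the set of chosen triples and \<open>M\<close> the pairing of the remaining indices.\<close>

definition LP1_choice :: "nat \<Rightarrow> nat \<Rightarrow> nat set set \<Rightarrow> nat set set \<Rightarrow> bool" where
  "LP1_choice l \<sigma> A M \<longleftrightarrow>
     odd l \<and> 3 \<le> l \<and> odd \<sigma> \<and> 1 \<le> \<sigma> \<and> \<sigma> \<le> l div 3 \<and>
     card A = \<sigma> \<and> disjoint A \<and> (\<forall>X\<in>A. X \<subseteq> {..<l} \<and> card X = 3) \<and>
     disjoint M \<and> (\<forall>e\<in>M. card e = 2) \<and> \<Union>M = {..<l} - \<Union>A"

definition graph_iso ::
    "('a \<Rightarrow> 'b) \<Rightarrow> 'a set \<Rightarrow> 'a set set \<Rightarrow> 'b set \<Rightarrow> 'b set set \<Rightarrow> bool" where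
  "graph_iso \<phi> V E V' E' \<longleftrightarrow> bij_betw \<phi> V V' \<and> E' = (\<lambda>e. \<phi> ` e) ` E"

definition LP1_snark :: "nat \<Rightarrow> nat \<Rightarrow> 'a set \<Rightarrow> 'a set set \<Rightarrow> bool" where
  "LP1_snark l \<sigma> V E \<longleftrightarrow>
     (\<exists>c A M \<phi>. LP1_choice l \<sigma> A M \<and>
        graph_iso \<phi> (LP1_verts l A) (LP1_edges l c A M) V E)"

lemma simple_graph_LP1:
  assumes "LP1_choice l \<sigma> A M"
  shows "simple_graph (LP1_verts l A) (LP1_edges l c A M)"
proof -
  have l: "l \<ge> 3" and A: "\<And>X. X \<in> A \<Longrightarrow> X \<subseteq> {..<l}"
    and M: "\<And>e. e \<in> M \<Longrightarrow> card e = 2" "\<Union>M \<subseteq> {..<l}"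
    using assms unfolding LP1_choice_def by blast+
  have "A \<subseteq> Pow {..<l}"
    using A by blast
  then have fA: "finite A"
    by (rule finite_subset) simp
  have m: "(i + 1) mod l < l" for i
    using l by simp
  have "e \<subseteq> LP1_verts l A \<and> card e = 2" if e: "e \<in> LP1_edges l c A M" for e
  proof -
    consider i where "i < l" "e \<in> block_edges i"
      | i where "i < l" "e \<in> plug_edges l c i"
      | X i where "X \<in> A" "i \<in> X" "e = {Link X, Tv i}"
      | i j where "{i, j} \<in> M" "e = {Tv i, Tv j}"
      using e unfolding LP1_edges_def link_edges_def repairing_edges_def by blast
    then show ?thesis
    proof cases
      case 1
      then show ?thesis
        by (auto simp: block_edges_def LP1_verts_def block_verts_def)
    next
      case 2
      then show ?thesis
        using m[of i] by (auto simp: plug_edges_def LP1_verts_def block_verts_def split: if_splits)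
    next
      case 3
      then show ?thesis
        using A[of X] by (auto simp: LP1_verts_def block_verts_def)
    next
      case 4
      have "i \<noteq> j"
        using M(1)[OF 4(1)] by (cases "i = j") auto
      moreover have "i < l" "j < l"
        using M(2) 4(1) by auto
      ultimately show ?thesis
        using 4 by (auto simp: LP1_verts_def block_verts_def)
    qed
  qed
  moreover have "finite (LP1_verts l A)"
    using fA by (auto simp: LP1_verts_def block_verts_def)
  ultimately show ?thesis
    by (simp add: simple_graph_def)
qed

lemma simple_graph_LP1_snark:
  assumes "LP1_snark l \<sigma> V E"
  shows "simple_graph V E"
proof -
  obtain c A M \<phi> where ch: "LP1_choice l \<sigma> A M"
    and iso: "graph_iso \<phi> (LP1_verts l A) (LP1_edges l c A M) V E"
    using assms unfolding LP1_snark_def by blast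
  note sg = simple_graph_LP1[OF ch, of c, unfolded simple_graph_def]
  have inj: "inj_on \<phi> (LP1_verts l A)" and V: "V = \<phi> ` LP1_verts l A"
    and E: "E = (\<lambda>e. \<phi> ` e) ` LP1_edges l c A M"
    using iso by (auto simp: graph_iso_def bij_betw_def)
  have "e \<subseteq> V \<and> card e = 2" if e: "e \<in> E" for e
  proof -
    obtain d where d: "d \<in> LP1_edges l c A M" "e = \<phi> ` d"
      using e E by blast
    with sg have "d \<subseteq> LP1_verts l A" "card d = 2" by auto
    then show ?thesis
      using d V inj by (auto simp: card_image inj_on_subset)
  qed
  then show ?thesis
    using sg V by (simp add: simple_graph_def)
qed

lemma ex_independent_k_roman_dominating:
  assumes "simple_graph V E"
  shows "\<exists>f. independent_k_roman_dominating k V E f"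
proof -
  have fin: "finite V" and E: "\<And>e. e \<in> E \<Longrightarrow> e \<subseteq> V \<and> card e = 2"
    using assms by (auto simp: simple_graph_def)
  define I where "I = {S. S \<subseteq> V \<and> independent_set E S}"
  have "I \<subseteq> Pow V"
    by (auto simp: I_def)
  then have "finite I"
    using fin by (simp add: finite_subset)
  moreover have "{} \<in> I"
    by (simp add: I_def independent_set_def)
  ultimately have "\<exists>S\<in>I. \<forall>T\<in>I. S \<subseteq> T \<longrightarrow> S = T"
    by (intro finite_has_maximal) auto
  then obtain S where S_I: "S \<in> I" and max: "\<forall>T\<in>I. S \<subseteq> T \<longrightarrow> S = T"
    by (rule bexE)
  then have S: "S \<subseteq> V" "independent_set E S"
    by (simp_all add: I_def)
  define f where "f v = (if v \<in> S then k + 1 else 0)" for v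
  have act: "active_nbhd E f v = nbhd E v \<inter> S" for v
    by (auto simp: active_nbhd_def f_def)
  have "k + card (active_nbhd E f v) \<le> sum f (closed_nbhd E v)"
    if v: "v \<in> V" "v \<notin> S" for v
  proof -
    have loop: "{v} \<notin> E" using E[of "{v}"] by auto
    have "\<not> independent_set E (insert v S)"
      using max S(1) v unfolding I_def by blast
    then obtain w where w: "w \<in> S" "{v, w} \<in> E"
      using S(2) loop by (auto simp: independent_set_def insert_commute)
    have "nbhd E v \<subseteq> V"
      using E by (force simp: nbhd_def)
    then have finN: "finite (closed_nbhd E v)"
      using finite_subset[OF _ fin] by (simp add: closed_nbhd_def)
    let ?a = "card (nbhd E v \<inter> S)"
    have "?a \<ge> 1"
      using w finN by (auto simp: closed_nbhd_def nbhd_def card_gt_0_iff Suc_le_eq)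
    have "sum f (closed_nbhd E v) = sum f (closed_nbhd E v \<inter> S)"
      using finN by (intro sum.mono_neutral_right) (auto simp: f_def)
    also have "closed_nbhd E v \<inter> S = nbhd E v \<inter> S"
      using v by (auto simp: closed_nbhd_def)
    also have "sum f (nbhd E v \<inter> S) = ?a * (k + 1)"
      by (simp add: f_def)
    finally show ?thesis
      using mult_le_mono1[OF \<open>?a \<ge> 1\<close>, of k] by (simp add: act algebra_simps)
  qed
  then have "k_roman_dominating k V E f"
    by (auto simp: k_roman_dominating_def f_def split: if_splits)
  moreover have "independent_set E {v \<in> V. f v > 0}"
    using S(2) by (auto simp: independent_set_def f_def split: if_splits)
  ultimately show ?thesis
    unfolding independent_k_roman_dominating_def by blast
qed

lemma i_kR_attained:
  assumes "simple_graph V E"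
  shows "\<exists>f. independent_k_roman_dominating k V E f \<and> (\<Sum>v\<in>V. f v) = i_kR k V E"
proof -
  let ?W = "{(\<Sum>v\<in>V. f v) | f. independent_k_roman_dominating k V E f}"
  have "?W \<noteq> {}"
    using ex_independent_k_roman_dominating[OF assms, of k] by blast
  then have "Inf ?W \<in> ?W"
    by (rule Inf_nat_def1)
  then show ?thesis
    unfolding i_kR_def by auto
qed

end

theory Submission
  imports Defs
begin

text \<open>In each block the vertices \<open>p\<^sub>i\<close> and \<open>q\<^sub>i\<close> are non-adjacent, dominate the whole block and
  meet no edge leaving it. Label all of them \<open>k + 1\<close> and every link-vertex \<open>k\<close>: a link-vertex is
  adjacent only to vertices \<open>t\<^sub>i\<close>, so the support is independent, and a vertex with label \<open>k\<close>
  carries no domination condition.\<close>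

lemma finite_nbhd:
  assumes "simple_graph V E"
  shows "finite (nbhd E v)"
proof -
  have "nbhd E v \<subseteq> V"
    using assms by (auto simp: simple_graph_def nbhd_def)
  then show ?thesis
    using assms by (auto simp: simple_graph_def intro: finite_subset)
qed

lemma i_kR_le:
  assumes "independent_k_roman_dominating k V E f"
  shows "i_kR k V E \<le> (\<Sum>v\<in>V. f v)"
  unfolding i_kR_def using assms by (intro wellorder_Inf_le1) auto

text \<open>Label \<open>D\<close> by \<open>k + 1\<close> and \<open>L\<close> by \<open>k\<close>;
  only vertices outside \<open>D \<union> L\<close> then have a condition to meet. Such a vertex has
  a neighbour \<open>d\<close> in \<open>D\<close>, whose label pays for \<open>k\<close> and for
  the one unit that \<open>d\<close> adds to the active count. Every other active neighbour has
  label at least 1 and so pays for its own unit.\<close>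

lemma i_kR_le_dominating:
  assumes G: "simple_graph V E" and k: "k \<ge> 1"
    and DL: "D \<subseteq> V" "L \<subseteq> V" and indep: "independent_set E (D \<union> L)"
    and dom: "\<And>v. v \<in> V - (D \<union> L) \<Longrightarrow> \<exists>d\<in>D. {v, d} \<in> E"
  shows "i_kR k V E \<le> (k + 1) * card D + k * card L"
proof -
  define f where "f v = (if v \<in> D then k + 1 else if v \<in> L then k else 0)" for v
  have fin: "finite V"
    using G by (simp add: simple_graph_def)
  have f_pos: "f v > 0 \<longleftrightarrow> v \<in> D \<union> L" for v
    using k by (simp add: f_def)
  have "k + card (active_nbhd E f v) \<le> sum f (closed_nbhd E v)" if v: "v \<in> V" "f v < k" for v
  proof -
    let ?N = "active_nbhd E f v"
    have "v \<in> V - (D \<union> L)"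
      using v by (auto simp: f_def split: if_splits)
    then obtain d where d: "d \<in> D" "{v, d} \<in> E"
      using dom by blast
    then have dN: "d \<in> ?N"
      by (simp add: active_nbhd_def nbhd_def f_def)
    have finC: "finite (closed_nbhd E v)"
      using finite_nbhd[OF G] by (simp add: closed_nbhd_def)
    have sub: "?N \<subseteq> closed_nbhd E v"
      by (auto simp: active_nbhd_def closed_nbhd_def)
    have finN: "finite ?N"
      using sub finC by (rule finite_subset)
    have "card (?N - {d}) \<le> sum f (?N - {d})"
      using sum_mono[of "?N - {d}" "\<lambda>_. 1" f] by (simp add: active_nbhd_def)
    then have "k + card ?N \<le> f d + sum f (?N - {d})"
      using d(1) by (simp add: card.remove[OF finN dN] f_def)
    also have "\<dots> = sum f ?N"
      by (rule sum.remove[OF finN dN, symmetric])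
    also have "\<dots> \<le> sum f (closed_nbhd E v)"
      by (rule sum_mono2[OF finC sub]) simp
    finally show ?thesis .
  qed
  then have "k_roman_dominating k V E f"
    by (auto simp: k_roman_dominating_def f_def)
  moreover have "independent_set E {v \<in> V. f v > 0}"
    using indep by (simp add: f_pos independent_set_def)
  ultimately have "i_kR k V E \<le> sum f V"
    by (intro i_kR_le) (simp add: independent_k_roman_dominating_def)
  \<comment> \<open>An inequality, since \<open>D\<close> and \<open>L\<close> may overlap: a common
    vertex has label \<open>k + 1\<close> but is counted on the right with
    \<open>k + 1 + k\<close>.\<close>
  also have "\<dots> \<le> (\<Sum>v\<in>V. (if v \<in> D then k + 1 else 0) + (if v \<in> L then k else 0))"
    by (rule sum_mono) (simp add: f_def)
  also have "\<dots> = (k + 1) * card D + k * card L"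
    using fin DL by (simp add: sum.distrib sum.If_cases Int_absorb1 mult.commute)
  finally show ?thesis .
qed

lemma independent_set_subset:
  assumes "independent_set E S" and "T \<subseteq> S"
  shows "independent_set E T"
  using assms unfolding independent_set_def by blast

text \<open>Each edge of \<open>E'\<close> is the image of some \<open>e\<close> in
  \<open>E\<close>. Injectivity of \<open>\<phi>\<close> is available on \<open>V\<close> only, so
  simplicity of the graph is used to place \<open>e\<close> inside \<open>V\<close> before
  \<open>e\<close> is recovered from its image.\<close>

lemma independent_set_graph_iso:
  assumes iso: "graph_iso \<phi> V E V' E'" and G: "simple_graph V E"
    and S: "S \<subseteq> V" "independent_set E S"
  shows "independent_set E' (\<phi> ` S)"
proof -
  have inj: "inj_on \<phi> V" and E': "E' = (`) \<phi> ` E"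
    using iso by (auto simp: graph_iso_def bij_betw_def)
  have "{\<phi> x, \<phi> y} \<notin> E'" if xy: "x \<in> S" "y \<in> S" for x y
  proof
    assume "{\<phi> x, \<phi> y} \<in> E'"
    then obtain e where e: "e \<in> E" "\<phi> ` e = \<phi> ` {x, y}"
      using E' by auto
    moreover have "e \<subseteq> V" "{x, y} \<subseteq> V"
      using G e(1) S(1) xy by (auto simp: simple_graph_def)
    ultimately have "e = {x, y}"
      using inj_on_image_eq_iff[OF inj] by blast
    then show False
      using e(1) S(2) xy by (auto simp: independent_set_def)
  qed
  then show ?thesis
    by (auto simp: independent_set_def)
qed

lemma graph_iso_edge:
  assumes "graph_iso \<phi> V E V' E'" and "{x, y} \<in> E"
  shows "{\<phi> x, \<phi> y} \<in> E'"
proof -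
  have "\<phi> ` {x, y} \<in> E'"
    using assms unfolding graph_iso_def by blast
  then show ?thesis
    by simp
qed

text \<open>Every edge of any of the four kinds has an endpoint of type \<open>Rv\<close>,
  \<open>Sv\<close>, \<open>Tv\<close>, \<open>Uv\<close> or \<open>Vv\<close>, whatever its indices
  are.\<close>

lemma independent_set_LP1:
  "independent_set (LP1_edges l c A M) (range Pv \<union> range Qv \<union> range Link)"
  (is "independent_set _ ?S")
proof -
  have "e \<inter> (- ?S) \<noteq> {}" if e: "e \<in> LP1_edges l c A M" for e
  proof -
    consider i where "e \<in> block_edges i" | i where "e \<in> plug_edges l c i"
      | X i where "e = {Link X, Tv i}" | i j where "e = {Tv i, Tv j}"
      using e unfolding LP1_edges_def link_edges_def repairing_edges_def by blast
    then show ?thesis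
      by cases (auto simp: block_edges_def plug_edges_def split: if_splits)
  qed
  then show ?thesis
    unfolding independent_set_def by blast
qed

text \<open>Block edges suffice: \<open>Pv i\<close> is adjacent to \<open>Sv i\<close>,
  \<open>Tv i\<close>, \<open>Uv i\<close>, and \<open>Qv i\<close> to \<open>Rv i\<close>,
  \<open>Tv i\<close>, \<open>Vv i\<close>.\<close>

lemma LP1_dominated:
  assumes "v \<in> LP1_verts l A" and "v \<notin> Link ` A"
    and "v \<notin> Pv ` {..<l} \<union> Qv ` {..<l}"
  shows "\<exists>d \<in> Pv ` {..<l} \<union> Qv ` {..<l}. {v, d} \<in> LP1_edges l c A M"
proof -
  obtain i where i: "i < l" "v \<in> {Rv i, Sv i, Tv i, Uv i, Vv i}"
    using assms by (auto simp: LP1_verts_def block_verts_def)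
  then have "{v, Pv i} \<in> block_edges i \<or> {v, Qv i} \<in> block_edges i"
    by (auto simp: block_edges_def doubleton_eq_iff)
  then show ?thesis
    using i(1) by (auto simp: LP1_edges_def)
qed

theorem theorem5p1:
  fixes k l \<sigma> :: nat and V :: "'a set" and E :: "'a set set"
  assumes "k \<ge> 1" and "l \<ge> 3" and "odd l" and "\<sigma> \<ge> 1"
    and "LP1_snark l \<sigma> V E"
  shows "i_kR k V E \<le> 2 * (k + 1) * l + k * \<sigma>"
proof -
  obtain c A M \<phi> where ch: "LP1_choice l \<sigma> A M"
    and iso: "graph_iso \<phi> (LP1_verts l A) (LP1_edges l c A M) V E"
    using assms(5) unfolding LP1_snark_def by blast
  define D where "D = Pv ` {..<l} \<union> Qv ` {..<l}"
  define L where "L = Link ` A"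
  have sub: "D \<union> L \<subseteq> LP1_verts l A"
    by (auto simp: D_def L_def LP1_verts_def block_verts_def)
  have V: "V = \<phi> ` LP1_verts l A"
    using iso by (simp add: graph_iso_def bij_betw_def)
  \<comment> \<open>An infinite set has \<open>card\<close> 0, so \<open>\<sigma> \<ge> 1\<close>
    forces \<open>A\<close> to be finite.\<close>
  have A: "finite A" "card A = \<sigma>"
    using ch assms(4) by (auto simp: LP1_choice_def intro: card_ge_0_finite)
  have "independent_set (LP1_edges l c A M) (D \<union> L)"
    by (rule independent_set_subset[OF independent_set_LP1]) (auto simp: D_def L_def)
  then have indep: "independent_set E (\<phi> ` D \<union> \<phi> ` L)"
    using independent_set_graph_iso[OF iso simple_graph_LP1[OF ch] sub] by (simp add: image_Un)
  have dom: "\<exists>d\<in>\<phi> ` D. {v, d} \<in> E" if v: "v \<in> V - (\<phi> ` D \<union> \<phi> ` L)" for v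
  proof -
    obtain w where w: "v = \<phi> w" "w \<in> LP1_verts l A" "w \<notin> D" "w \<notin> L"
      using v V by blast
    then obtain d where "d \<in> D" "{w, d} \<in> LP1_edges l c A M"
      using LP1_dominated[of w l A c M] unfolding D_def L_def by blast
    then show ?thesis
      using graph_iso_edge[OF iso] w(1) by blast
  qed
  \<comment> \<open>The bound on the weight is monotone in both cardinalities, so upper bounds on
    the sizes of the images are enough.\<close>
  have "card D \<le> l + l"
    unfolding D_def using card_image_le[of "{..<l}" Pv] card_image_le[of "{..<l}" Qv]
    by (intro order_trans[OF card_Un_le]) simp
  then have cD: "card (\<phi> ` D) \<le> 2 * l"
    using card_image_le[of D \<phi>] by (simp add: D_def)
  have cL: "card (\<phi> ` L) \<le> \<sigma>"
    using card_image_le[OF A(1), of "\<phi> \<circ> Link"] A(2) by (simp add: L_def image_comp)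
  have "i_kR k V E \<le> (k + 1) * card (\<phi> ` D) + k * card (\<phi> ` L)"
    using sub V indep dom
    by (intro i_kR_le_dominating simple_graph_LP1_snark[OF assms(5)] assms(1)) auto
  also have "\<dots> \<le> (k + 1) * (2 * l) + k * \<sigma>"
    using cD cL by (intro add_mono mult_le_mono2)
  finally show ?thesis
    by (simp add: mult_ac)
qed

end
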